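(* Let $n\ge 1$ and let $x_j^i\ge 2$ be integers for each $j=1,\dots,n$ and each $i=1,\dots,n+1$. For $1\le k\le n$ and $\{i_1<\dots<i_{k+1}\}\subseteq\{1,\dots,n+1\}$ define the set $$X_k(i_1,\dots,i_{k+1})=\left\{\frac{x_k^{i_1}\cdots x_k^{i_{k+1}}}{x_k^{i_{k+1}}},\dots,\frac{x_k^{i_1}\cdots x_k^{i_{k+1}}}{x_k^{i_1}}\right\},$$ i.e. the set of the $k+1$ products obtained from $x_k^{i_1}\cdots x_k^{i_{k+1}}$ by omitting one factor. Suppose that $\gcd(X_k(i_1,\dots,i_{k+1}))=1$ for every $1\le k\le n$ and every $\{i_1<\dots<i_{k+1}\}\subseteq\{1,\dots,n+1\}$, and let $$g_n=\max_{1\le k\le n}\max\{\,g(X_k(i_1,\dots,i_{k+1}))\;:\;\{i_1<\dots<i_{k+1}\}\subseteq\{1,\dots,n+1\}\,\}.$$ Then for all positive integers $a_1,\dots,a_n$ with $a_j>g_n$ for every $1\le j\le n$, the $n$-dimensional rectangle $(a_1\times\cdots\times a_n)$ can be tiled with the bricks $X^i=(x_1^i\times\cdots\times x_n^i)$, $i=1,\dots,n+1$.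
   Context: For positive integers $a_1,\dots,a_n$, $(a_1\times\cdots\times a_n)$ denotes the $n$-dimensional rectangle $\{(y_1,\dots,y_n)\in\mathbb{R}^n: 0\le y_i\le a_i\}$. A rectangle $A$ is tiled with bricks (smaller $n$-dimensional rectangles) $B_1,\dots,B_k$ if $A$ is the union of finitely many copies of the $B_i$ (translated, and rotations allowed) with pairwise disjoint interiors. For a finite set $S$ of positive integers with $\gcd(S)=1$, the Frobenius number $g(S)$ is the largest integer that is not representable as a nonnegative integer combination of the elements of $S$. *)

theory Defs
  imports
    "HOL-Analysis.Function_Topology"
    "Jordan_Normal_Form.Determinant"
begin

text \<open>
  Points of \<open>\<real>\<^sup>n\<close> are functions on \<open>{1..n}\<close>, extended by \<open>undefined\<close> outside of it, with the
  product topology.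
\<close>

definition Rn :: "nat \<Rightarrow> (nat \<Rightarrow> real) topology" where
  "Rn n = product_topology (\<lambda>_. euclideanreal) {1..n}"

definition rectangle :: "nat \<Rightarrow> (nat \<Rightarrow> nat) \<Rightarrow> (nat \<Rightarrow> real) set" where
  "rectangle n a = {y \<in> topspace (Rn n). \<forall>j\<in>{1..n}. 0 \<le> y j \<and> y j \<le> real (a j)}"

definition rotation_mat :: "nat \<Rightarrow> real mat \<Rightarrow> bool" where
  "rotation_mat n R \<longleftrightarrow>
     R \<in> carrier_mat n n \<and> R\<^sup>T * R = 1\<^sub>m n \<and> det R = 1"

text \<open>Matrix entries are indexed from 0, whereas the coordinates of points are indexed from 1.\<close>

definition rigid_motion :: "nat \<Rightarrow> real mat \<Rightarrow> (nat \<Rightarrow> real) \<Rightarrow> (nat \<Rightarrow> real) \<Rightarrow> nat \<Rightarrow> real" where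
  "rigid_motion n R v y = (\<lambda>j\<in>{1..n}. (\<Sum>l = 1..n. R $$ (j - 1, l - 1) * y l) + v j)"

definition is_copy :: "nat \<Rightarrow> (nat \<Rightarrow> real) set \<Rightarrow> (nat \<Rightarrow> real) set \<Rightarrow> bool" where
  "is_copy n B C \<longleftrightarrow> (\<exists>R v. rotation_mat n R \<and> C = rigid_motion n R v ` B)"

text \<open>
  Taking the copies as a set loses nothing: two equal copies of a brick with positive side
  lengths never have disjoint interiors.
\<close>

definition can_be_tiled :: "nat \<Rightarrow> (nat \<Rightarrow> real) set \<Rightarrow> (nat \<Rightarrow> real) set set \<Rightarrow> bool" where
  "can_be_tiled n A \<B> \<longleftrightarrow>
     (\<exists>\<C>. finite \<C> \<and> (\<forall>C\<in>\<C>. \<exists>B\<in>\<B>. is_copy n B C) \<and> A = \<Union>\<C> \<and>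
          pairwise (\<lambda>C D. disjnt (Rn n interior_of C) (Rn n interior_of D)) \<C>)"

definition representable :: "nat set \<Rightarrow> int \<Rightarrow> bool" where
  "representable S m \<longleftrightarrow> (\<exists>c :: nat \<Rightarrow> nat. m = int (\<Sum>s\<in>S. c s * s))"

definition frobenius_number :: "nat set \<Rightarrow> int" where
  "frobenius_number S = (GREATEST m. \<not> representable S m)"

text \<open>Here \<open>x j i\<close> is the \<open>j\<close>-th side length of the \<open>i\<close>-th brick.\<close>

definition X_set :: "(nat \<Rightarrow> nat \<Rightarrow> nat) \<Rightarrow> nat \<Rightarrow> nat set \<Rightarrow> nat set" where
  "X_set x k I = (\<lambda>l. (\<Prod>i\<in>I. x k i) div x k l) ` I"

definition g_max :: "nat \<Rightarrow> (nat \<Rightarrow> nat \<Rightarrow> nat) \<Rightarrow> int" where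
  "g_max n x =
     Max ((\<lambda>k. Max {frobenius_number (X_set x k I) | I. I \<subseteq> {1..n+1} \<and> card I = k + 1}) ` {1..n})"

end

theory Submission
  imports Defs
begin

text \<open>
  For \<open>I \<subseteq> {1..n+1}\<close> with \<open>k + 1\<close> elements, the bricks with index in \<open>I\<close> tile every box whose first
  \<open>k\<close> sides exceed \<open>g_max n x\<close> and whose \<open>j\<close>-th side is divisible by \<open>\<Prod>i\<in>I. x j i\<close> for \<open>j > k\<close>. This
  is shown by induction on \<open>k\<close>. For \<open>k = 0\<close> a grid of translates of a single brick does it. In the
  step, the \<open>k\<close>-th side is a nonnegative combination of the products over \<open>I - {l}\<close>, \<open>l \<in> I\<close>, and
  slicing the box accordingly leaves slabs to which the induction hypothesis for \<open>I - {l}\<close>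
  applies. No rotations are needed.
\<close>

section \<open>Frobenius numbers\<close>

text \<open>Induction on \<open>S\<close>, combining the new element with the gcd of the earlier
  ones by two-term Bezout; the old coefficients are scaled by \<open>q\<close>.\<close>

lemma bezout_finite_set:
  fixes S :: "nat set"
  assumes "finite S"
  shows "\<exists>u :: nat \<Rightarrow> int. (\<Sum>s\<in>S. u s * int s) = int (Gcd S)"
  using assms
proof (induction S rule: finite_induct)
  case empty
  then show ?case by simp
next
  case (insert s S)
  then obtain u :: "nat \<Rightarrow> int" where u: "(\<Sum>t\<in>S. u t * int t) = int (Gcd S)"
    by blast
  obtain p q where pq: "p * int s + q * int (Gcd S) = gcd (int s) (int (Gcd S))"
    using bezout_int by blast
  define w where "w t = (if t = s then p else q * u t)" for t
  have "(\<Sum>t\<in>S. w t * int t) = (\<Sum>t\<in>S. q * (u t * int t))"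
    using insert.hyps by (intro sum.cong) (auto simp: w_def)
  also have "\<dots> = q * int (Gcd S)"
    by (simp flip: sum_distrib_left add: u)
  finally have "(\<Sum>t\<in>insert s S. w t * int t) = p * int s + q * int (Gcd S)"
    using insert.hyps by (simp add: w_def)
  then show ?case
    using pq by (auto intro!: exI[of _ w])
qed

lemma representable_nonneg:
  assumes "representable S m"
  shows "m \<ge> 0"
  using assms by (auto simp: representable_def simp del: of_nat_sum)

text \<open>With \<open>T\<close> the sum of \<open>S\<close>, write \<open>m = q * T + r\<close>
  where \<open>0 \<le> r < T\<close>. Replacing \<open>r\<close> by \<open>r\<close> times a Bezout
  combination equal to 1 gives \<open>s\<close> the coefficient \<open>q + r * u s\<close>, which is
  nonnegative once \<open>q \<ge> T * K\<close>, where \<open>K\<close> bounds every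
  \<open>\<bar>u s\<bar>\<close>.\<close>

lemma eventually_representable:
  assumes "finite S" and "Gcd S = 1"
  shows "\<exists>N. \<forall>m\<ge>N. representable S m"
proof -
  obtain u :: "nat \<Rightarrow> int" where u: "(\<Sum>s\<in>S. u s * int s) = 1"
    using bezout_finite_set[OF assms(1)] assms(2) by auto
  define T where "T = (\<Sum>s\<in>S. int s)"
  define K where "K = (\<Sum>s\<in>S. \<bar>u s\<bar>)"
  have "T \<ge> 0"
    unfolding T_def by (rule sum_nonneg) simp
  moreover have "T \<noteq> 0"
  proof
    assume "T = 0"
    then have "\<forall>s\<in>S. int s = 0"
      unfolding T_def using assms(1) by (subst (asm) sum_nonneg_eq_0_iff) auto
    then have "(\<Sum>s\<in>S. u s * int s) = 0" by (intro sum.neutral) simp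
    with u show False by simp
  qed
  ultimately have T: "T > 0" by simp
  have K: "\<bar>u s\<bar> \<le> K" if "s \<in> S" for s
    unfolding K_def using assms(1) that by (intro member_le_sum) auto
  have "representable S m" if m: "m \<ge> T * (T * K)" for m
  proof -
    define q where "q = m div T"
    define r where "r = m mod T"
    have r: "0 \<le> r" "r < T" and mqr: "m = q * T + r"
      using T by (auto simp: q_def r_def)
    have q: "q \<ge> T * K"
      unfolding q_def using zdiv_mono1[OF m T] T by simp
    have nonneg: "q + r * u s \<ge> 0" if "s \<in> S" for s
    proof -
      have "\<bar>r * u s\<bar> \<le> T * K"
        unfolding abs_mult using r K[OF that] by (intro mult_mono) auto
      with q show ?thesis by linarith
    qed
    have "m = q * (\<Sum>s\<in>S. int s) + r * (\<Sum>s\<in>S. u s * int s)"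
      using mqr u by (simp add: T_def)
    also have "\<dots> = (\<Sum>s\<in>S. (q + r * u s) * int s)"
      by (simp add: sum_distrib_left sum.distrib algebra_simps)
    also have "\<dots> = (\<Sum>s\<in>S. int (nat (q + r * u s) * s))"
      using nonneg by (intro sum.cong) auto
    finally show ?thesis
      unfolding representable_def by (intro exI[of _ "\<lambda>s. nat (q + r * u s)"]) simp
  qed
  then show ?thesis by blast
qed

text \<open>\<open>GREATEST\<close> is meaningful only if a greatest non-representable integer
  exists. It does: these integers are bounded above because \<open>Gcd S = 1\<close>, and -1 is one
  of them.\<close>

lemma representable_above_frobenius_number:
  assumes "finite S" and "Gcd S = 1" and "m > frobenius_number S"
  shows "representable S m"
proof (rule ccontr)
  assume m: "\<not> representable S m"
  obtain N where N: "\<And>m. m \<ge> N \<Longrightarrow> representable S m"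
    using eventually_representable[OF assms(1,2)] by blast
  \<comment> \<open>Cutting off at -1 makes the set finite and keeps it nonempty even if
    \<open>1 \<in> S\<close>, when the Frobenius number is -1. All smaller integers lie below
    \<open>-1 \<in> F\<close>.\<close>
  define F where "F = {m. \<not> representable S m \<and> -1 \<le> m}"
  have "F \<subseteq> {-1..N}"
  proof
    fix m assume "m \<in> F"
    with N[of m] show "m \<in> {-1..N}"
      unfolding F_def by (cases "N \<le> m") simp_all
  qed
  then have "finite F"
    by (rule finite_subset) simp
  moreover have "-1 \<in> F"
    using representable_nonneg[of S "-1"] by (auto simp: F_def)
  ultimately have Max: "Max F \<in> F" and le: "\<And>y. y \<in> F \<Longrightarrow> y \<le> Max F"
    by (auto intro: Max_in)
  have bound: "y \<le> Max F" if "\<not> representable S y" for y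
    using that le[of y] le[OF \<open>-1 \<in> F\<close>] by (cases "y \<ge> -1") (simp_all add: F_def)
  have "frobenius_number S = Max F"
    unfolding frobenius_number_def
  proof (rule Greatest_equality)
    show "\<not> representable S (Max F)"
      using Max unfolding F_def by blast
  qed (rule bound)
  with bound[OF m] assms(3) show False by simp
qed

lemma frobenius_number_le_g_max:
  assumes "k \<in> {1..n}" and "I \<subseteq> {1..n+1}" and "card I = k + 1"
  shows "frobenius_number (X_set x k I) \<le> g_max n x"
proof -
  let ?A = "\<lambda>k. {frobenius_number (X_set x k I) | I. I \<subseteq> {1..n+1} \<and> card I = k + 1}"
  have "finite (?A k)"
    by (rule finite_subset[of _ "(\<lambda>I. frobenius_number (X_set x k I)) ` Pow {1..n+1}"]) auto
  then have "frobenius_number (X_set x k I) \<le> Max (?A k)"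
    using assms by (intro Max_ge) auto
  also have "\<dots> \<le> g_max n x"
    unfolding g_max_def using assms(1) by (intro Max_ge) auto
  finally show ?thesis .
qed

section \<open>Tilings by translates\<close>

definition box :: "nat \<Rightarrow> (nat \<Rightarrow> real) \<Rightarrow> (nat \<Rightarrow> nat) \<Rightarrow> (nat \<Rightarrow> real) set" where
  "box n v a = {y \<in> topspace (Rn n). \<forall>j\<in>{1..n}. v j \<le> y j \<and> y j \<le> v j + real (a j)}"

lemma topspace_Rn: "topspace (Rn n) = extensional {1..n}"
  by (simp add: Rn_def PiE_def)

lemma box_zero: "box n (\<lambda>_. 0) a = rectangle n a"
  by (simp add: box_def rectangle_def)

lemma box_cong:
  assumes "\<And>j. j \<in> {1..n} \<Longrightarrow> a j = b j"
  shows "box n v a = box n v b"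
  using assms by (auto simp: box_def)

lemma rotation_mat_one: "rotation_mat n (1\<^sub>m n)"
  by (simp add: rotation_mat_def)

lemma rigid_motion_one: "rigid_motion n (1\<^sub>m n) v y = (\<lambda>j\<in>{1..n}. y j + v j)"
proof -
  have "(\<Sum>l = 1..n. 1\<^sub>m n $$ (j - 1, l - 1) * y l) = y j" if "j \<in> {1..n}" for j
  proof -
    have "(\<Sum>l = 1..n. 1\<^sub>m n $$ (j - 1, l - 1) * y l) = (\<Sum>l = 1..n. if l = j then y l else 0)"
      using that by (intro sum.cong) auto
    also have "\<dots> = y j"
      using that by simp
    finally show ?thesis .
  qed
  then show ?thesis
    unfolding rigid_motion_def by (intro restrict_ext) simp
qed

text \<open>The identity matrix is a rotation, so every translate is a copy.\<close>

lemma is_copy_box: "is_copy n (rectangle n a) (box n v a)"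
proof -
  have "box n v a = rigid_motion n (1\<^sub>m n) v ` rectangle n a"
  proof (intro equalityI subsetI)
    fix y assume y: "y \<in> box n v a"
    have "(\<lambda>j\<in>{1..n}. y j - v j) \<in> rectangle n a"
      using y by (auto simp: box_def rectangle_def topspace_Rn algebra_simps)
    moreover have "y = rigid_motion n (1\<^sub>m n) v (\<lambda>j\<in>{1..n}. y j - v j)"
      using y unfolding rigid_motion_one
      by (intro extensionalityI[of _ "{1..n}"]) (auto simp: box_def topspace_Rn)
    ultimately show "y \<in> rigid_motion n (1\<^sub>m n) v ` rectangle n a"
      by blast
  next
    fix y assume "y \<in> rigid_motion n (1\<^sub>m n) v ` rectangle n a"
    then show "y \<in> box n v a"
      unfolding rigid_motion_one by (auto simp: box_def rectangle_def topspace_Rn)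
  qed
  then show ?thesis
    unfolding is_copy_def using rotation_mat_one by blast
qed

text \<open>Coordinate projections of a product space are open maps, so a nonempty interior would be
  projected onto the open set \<open>{c}\<close>, which is impossible in the reals.\<close>

lemma interior_of_hyperplane:
  assumes "j \<in> {1..n}" and "\<And>y. y \<in> H \<Longrightarrow> y j = c"
  shows "Rn n interior_of H = {}"
proof (rule ccontr)
  let ?U = "Rn n interior_of H"
  assume "?U \<noteq> {}"
  then have "(\<lambda>y. y j) ` ?U = {c}"
    using assms(2) interior_of_subset[of "Rn n" H] by fast
  moreover have "open ((\<lambda>y. y j) ` ?U)"
    using open_map_product_projection[OF assms(1), of "\<lambda>_. euclideanreal"] openin_interior_of[of "Rn n" H]
    unfolding open_map_def Rn_def by simp
  ultimately show False
    using not_open_singleton[of c] by simp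
qed

text \<open>Interiors commute with binary intersections, so the common interior of a tile of
  \<open>A\<close> and a tile of \<open>B\<close> lies in the empty interior of
  \<open>A \<inter> B\<close>.\<close>

lemma can_be_tiled_Un:
  assumes A: "can_be_tiled n A \<B>" and B: "can_be_tiled n B \<B>"
    and disj: "Rn n interior_of (A \<inter> B) = {}"
  shows "can_be_tiled n (A \<union> B) \<B>"
proof -
  let ?R = "\<lambda>C D. disjnt (Rn n interior_of C) (Rn n interior_of D)"
  obtain \<C> where \<C>: "finite \<C>" "\<forall>C\<in>\<C>. \<exists>B\<in>\<B>. is_copy n B C" "A = \<Union>\<C>" "pairwise ?R \<C>"
    using A unfolding can_be_tiled_def by blast
  obtain \<D> where \<D>: "finite \<D>" "\<forall>C\<in>\<D>. \<exists>B\<in>\<B>. is_copy n B C" "B = \<Union>\<D>" "pairwise ?R \<D>"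
    using B unfolding can_be_tiled_def by blast
  have cross: "?R C D" if "C \<in> \<C>" "D \<in> \<D>" for C D
  proof -
    have "Rn n interior_of (C \<inter> D) \<subseteq> Rn n interior_of (A \<inter> B)"
      using that \<C>(3) \<D>(3) by (intro interior_of_mono) blast
    with disj show ?thesis
      by (simp add: disjnt_def flip: interior_of_Int)
  qed
  then have "pairwise ?R (\<C> \<union> \<D>)"
    using \<C>(4) \<D>(4) unfolding pairwise_def by (blast intro: disjnt_sym)
  then show ?thesis
    unfolding can_be_tiled_def using \<C> \<D> by (intro exI[of _ "\<C> \<union> \<D>"]) auto
qed

text \<open>
  Quantifying over all positions makes it unnecessary to translate tilings. Degenerate boxes are
  included so that slices of thickness 0 are harmless.
\<close>

definition translates_tileable :: "nat \<Rightarrow> (nat \<Rightarrow> real) set set \<Rightarrow> (nat \<Rightarrow> nat) \<Rightarrow> bool" where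
  "translates_tileable n \<B> a \<longleftrightarrow>
     (\<forall>j\<in>{1..n}. a j > 0) \<longrightarrow> (\<forall>v. can_be_tiled n (box n v a) \<B>)"

lemma translates_tileable_cong:
  assumes "translates_tileable n \<B> a" and "\<And>j. j \<in> {1..n} \<Longrightarrow> a j = b j"
  shows "translates_tileable n \<B> b"
  using assms box_cong[of n a b] by (simp add: translates_tileable_def)

lemma translates_tileable_brick:
  assumes "rectangle n a \<in> \<B>"
  shows "translates_tileable n \<B> a"
  unfolding translates_tileable_def can_be_tiled_def
proof (intro impI allI)
  fix v
  show "\<exists>\<C>. finite \<C> \<and> (\<forall>C\<in>\<C>. \<exists>B\<in>\<B>. is_copy n B C) \<and> box n v a = \<Union>\<C> \<and>
          pairwise (\<lambda>C D. disjnt (Rn n interior_of C) (Rn n interior_of D)) \<C>"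
    using assms is_copy_box by (intro exI[of _ "{box n v a}"]) auto
qed

lemma translates_tileable_add:
  assumes j: "j \<in> {1..n}"
    and b: "translates_tileable n \<B> (a(j := b))" and c: "translates_tileable n \<B> (a(j := c))"
  shows "translates_tileable n \<B> (a(j := b + c))"
\<comment> \<open>If one thickness is 0, its hypothesis is vacuous and the other one is already the
  claim. Otherwise both thicknesses are positive, as the hypotheses require.\<close>
proof (cases "b = 0 \<or> c = 0")
  case True
  with b c show ?thesis by auto
next
  case False
  show ?thesis
    unfolding translates_tileable_def
  proof (intro impI allI)
    fix v :: "nat \<Rightarrow> real"
    assume pos: "\<forall>i\<in>{1..n}. (a(j := b + c)) i > 0"
    \<comment> \<open>The second slab starts where the first ends, so the two meet only in the
      hyperplane \<open>y j = v j + real b\<close>.\<close>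
    let ?w = "v(j := v j + real b)"
    have *: "box n v (a(j := b + c)) = box n v (a(j := b)) \<union> box n ?w (a(j := c))"
    proof (intro equalityI subsetI)
      fix y assume y: "y \<in> box n v (a(j := b + c))"
      show "y \<in> box n v (a(j := b)) \<union> box n ?w (a(j := c))"
        using y by (cases "y j \<le> v j + real b") (auto simp: box_def split: if_splits)
    next
      fix y assume y: "y \<in> box n v (a(j := b)) \<union> box n ?w (a(j := c))"
      have "v i \<le> y i \<and> y i \<le> v i + real ((a(j := b + c)) i)" if i: "i \<in> {1..n}" for i
      proof -
        have "(v i \<le> y i \<and> y i \<le> v i + real ((a(j := b)) i)) \<or>
              (?w i \<le> y i \<and> y i \<le> ?w i + real ((a(j := c)) i))"
          using y i unfolding box_def by blast
        then show ?thesis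
          by (cases "i = j") auto
      qed
      with y show "y \<in> box n v (a(j := b + c))"
        unfolding box_def by blast
    qed
    have "can_be_tiled n (box n v (a(j := b))) \<B>"
    proof -
      have "\<forall>i\<in>{1..n}. (a(j := b)) i > 0"
        using pos False by (simp split: if_splits) blast
      with b show ?thesis
        unfolding translates_tileable_def by blast
    qed
    moreover have "can_be_tiled n (box n ?w (a(j := c))) \<B>"
    proof -
      have "\<forall>i\<in>{1..n}. (a(j := c)) i > 0"
        using pos False by (simp split: if_splits) blast
      with c show ?thesis
        unfolding translates_tileable_def by blast
    qed
    moreover have "Rn n interior_of (box n v (a(j := b)) \<inter> box n ?w (a(j := c))) = {}"
    proof (rule interior_of_hyperplane[OF j])
      fix y assume "y \<in> box n v (a(j := b)) \<inter> box n ?w (a(j := c))"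
      then have "y j \<le> v j + real ((a(j := b)) j)" "?w j \<le> y j"
        using j unfolding box_def by blast+
      then show "y j = v j + real b"
        by simp
    qed
    ultimately show "can_be_tiled n (box n v (a(j := b + c))) \<B>"
      unfolding * by (rule can_be_tiled_Un)
  qed
qed

lemma translates_tileable_zero:
  assumes "j \<in> {1..n}"
  shows "translates_tileable n \<B> (a(j := 0))"
  using assms by (auto simp: translates_tileable_def)

lemma translates_tileable_mult:
  assumes "j \<in> {1..n}" and "translates_tileable n \<B> (a(j := d))"
  shows "translates_tileable n \<B> (a(j := c * d))"
proof (induction c)
  case 0
  then show ?case unfolding mult_0 by (rule translates_tileable_zero[OF assms(1)])
next
  case (Suc c)
  then show ?case unfolding mult_Suc by (rule translates_tileable_add[OF assms])
qed

lemma translates_tileable_sum: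
  assumes "j \<in> {1..n}" and "\<And>s. s \<in> S \<Longrightarrow> translates_tileable n \<B> (a(j := f s))"
  shows "translates_tileable n \<B> (a(j := sum f S))"
  using assms(2)
proof (induction S rule: infinite_finite_induct)
  case (insert s S)
  then show ?case
    unfolding sum.insert[OF insert.hyps] by (intro translates_tileable_add[OF assms(1)]) blast+
\<comment> \<open>The sum is 0 for the empty set and, by the default value of \<open>sum\<close>,
  for infinite \<open>S\<close>.\<close>
qed (simp_all only: sum.infinite sum.empty translates_tileable_zero[OF assms(1)] not_False_eq_True)

lemma translates_tileable_grid:
  assumes "rectangle n b \<in> \<B>" and "\<And>j. j \<in> {1..n} \<Longrightarrow> b j dvd a j"
  shows "translates_tileable n \<B> a"
proof -
  \<comment> \<open>\<open>J\<close> holds the directions in which the brick has already been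
    extended to the side of the target box.\<close>
  have "translates_tileable n \<B> (\<lambda>j. if j \<in> J then a j else b j)" if "J \<subseteq> {1..n}" for J
    using finite_subset[OF that finite_atLeastAtMost] that
  proof (induction J rule: finite_induct)
    case empty
    then show ?case using translates_tileable_brick[OF assms(1)] by simp
  next
    case (insert l J)
    let ?a = "\<lambda>j. if j \<in> J then a j else b j"
    obtain c where c: "a l = c * b l"
      using assms(2)[of l] insert.prems by (auto simp: dvd_def mult.commute)
    \<comment> \<open>As \<open>l \<notin> J\<close>, the side in direction \<open>l\<close> is
      still that of the brick.\<close>
    have "?a(l := b l) = ?a"
      using insert.hyps by auto
    then have "translates_tileable n \<B> (?a(l := c * b l))"
      using insert by (intro translates_tileable_mult) auto
    moreover have "?a(l := c * b l) = (\<lambda>j. if j \<in> insert l J then a j else b j)"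
      using c by auto
    ultimately show ?case by simp
  qed
  from this[of "{1..n}"] show ?thesis
    by (rule translates_tileable_cong) auto
qed

section \<open>Slicing\<close>

lemma translates_tileable_if_large_or_divisible:
  fixes x :: "nat \<Rightarrow> nat \<Rightarrow> nat"
  assumes pos: "\<And>j i. j \<in> {1..n} \<Longrightarrow> i \<in> {1..n+1} \<Longrightarrow> x j i > 0"
    and gcd: "\<And>k I. k \<in> {1..n} \<Longrightarrow> I \<subseteq> {1..n+1} \<Longrightarrow> card I = k + 1 \<Longrightarrow> Gcd (X_set x k I) = 1"
    and "k \<le> n" and "I \<subseteq> {1..n+1}" and "card I = k + 1"
    and "\<And>j. j \<in> {1..k} \<Longrightarrow> int (a j) > g_max n x"
    and "\<And>j. j \<in> {k+1..n} \<Longrightarrow> (\<Prod>i\<in>I. x j i) dvd a j"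
  shows "translates_tileable n {rectangle n (\<lambda>j. x j i) | i. i \<in> {1..n+1}} a"
  using assms(3-)
proof (induction k arbitrary: I a)
  case 0
  \<comment> \<open>For a single index the divisibility hypothesis says that brick \<open>i\<close>
    fits a whole number of times in every direction.\<close>
  then obtain i where "I = {i}"
    by (auto simp: card_1_singleton_iff)
  with "0.prems" show ?case
    by (intro translates_tileable_grid[of n "\<lambda>j. x j i"]) auto
next
  case (Suc k)
  let ?j = "Suc k" and ?\<B> = "{rectangle n (\<lambda>j. x j i) | i. i \<in> {1..n+1}}"
  have j: "?j \<in> {1..n}"
    using Suc.prems(1) by simp
  have fin: "finite I"
    using Suc.prems(2) finite_subset by blast
  have "representable (X_set x ?j I) (int (a ?j))"
  proof (rule representable_above_frobenius_number)
    show "finite (X_set x ?j I)"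
      using fin by (simp add: X_set_def)
    show "Gcd (X_set x ?j I) = 1"
      using gcd[OF j Suc.prems(2,3)] .
    show "frobenius_number (X_set x ?j I) < int (a ?j)"
      using frobenius_number_le_g_max[OF j Suc.prems(2,3), of x] Suc.prems(4)[of ?j] by simp
  qed
  then obtain c :: "nat \<Rightarrow> nat" where c: "a ?j = (\<Sum>s\<in>X_set x ?j I. c s * s)"
    unfolding representable_def using of_nat_eq_iff by blast
  have slab: "translates_tileable n ?\<B> (a(?j := s))" if "s \<in> X_set x ?j I" for s
  proof -
    \<comment> \<open>Several \<open>l\<close> may yield the same thickness \<open>s\<close>; any
      one of them serves as the brick index to drop.\<close>
    obtain l where l: "l \<in> I" "s = (\<Prod>i\<in>I. x ?j i) div x ?j l"
      using \<open>s \<in> X_set x ?j I\<close> by (auto simp: X_set_def)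
    have "x ?j l > 0"
      using l(1) Suc.prems(2) j by (intro pos) auto
    then have s: "s = (\<Prod>i\<in>I - {l}. x ?j i)"
      using l fin by (simp add: prod.remove[of I l])
    show ?thesis
    \<comment> \<open>Direction \<open>?j\<close> now joins the divisible ones, since its side
      \<open>s\<close> is exactly the product over \<open>I - {l}\<close>. In later directions that
      product divides the one over \<open>I\<close>, and the first \<open>k\<close> sides are
      unchanged.\<close>
    proof (rule Suc.IH[of "I - {l}"])
      fix j' assume j': "j' \<in> {k + 1..n}"
      show "(\<Prod>i\<in>I - {l}. x j' i) dvd (a(?j := s)) j'"
      proof (cases "j' = ?j")
        case False
        have "(\<Prod>i\<in>I - {l}. x j' i) dvd (\<Prod>i\<in>I. x j' i)"
          using fin by (intro prod_dvd_prod_subset) auto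
        also have "\<dots> dvd a j'"
          using j' False by (intro Suc.prems(5)) auto
        finally show ?thesis
          using False by simp
      qed (simp add: s)
    qed (use Suc.prems l(1) fin in auto)
  qed
  \<comment> \<open>The box is cut into \<open>c s\<close> slabs of thickness \<open>s\<close> for
    each \<open>s\<close>.\<close>
  have "translates_tileable n ?\<B> (a(?j := \<Sum>s\<in>X_set x ?j I. c s * s))"
    using slab by (intro translates_tileable_sum translates_tileable_mult j)
  then show ?case
    by (simp flip: c)
qed

theorem theorem2p1:
  fixes n :: nat and x :: "nat \<Rightarrow> nat \<Rightarrow> nat" and a :: "nat \<Rightarrow> nat"
  assumes "n \<ge> 1"
    and "\<And>j i. j \<in> {1..n} \<Longrightarrow> i \<in> {1..n+1} \<Longrightarrow> x j i \<ge> 2"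
    and "\<And>k I. k \<in> {1..n} \<Longrightarrow> I \<subseteq> {1..n+1} \<Longrightarrow> card I = k + 1 \<Longrightarrow> Gcd (X_set x k I) = 1"
    and "\<And>j. j \<in> {1..n} \<Longrightarrow> a j > 0"
    and "\<And>j. j \<in> {1..n} \<Longrightarrow> int (a j) > g_max n x"
  shows "can_be_tiled n (rectangle n a) {rectangle n (\<lambda>j. x j i) | i. i \<in> {1..n+1}}"
proof -
  have "translates_tileable n {rectangle n (\<lambda>j. x j i) | i. i \<in> {1..n+1}} a"
  \<comment> \<open>With \<open>k = n\<close> the divisibility condition ranges over the empty
    interval \<open>{n+1..n}\<close>, and all bricks are available.\<close>
  proof (rule translates_tileable_if_large_or_divisible[of n x n "{1..n+1}"])
    show "x j i > 0" if "j \<in> {1..n}" "i \<in> {1..n+1}" for j i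
      using assms(2)[OF that] by simp
  qed (use assms(3,5) in auto)
  then show ?thesis
    using assms(4) by (simp add: translates_tileable_def flip: box_zero)
qed

end
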